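(* Let $n\in\mathbb{N}_0$ and let $x\in\mathbb{C}$ with $\operatorname{Re}x>0$. Then $$P_n(n+1, x) = \frac{\Gamma(x)}{\Gamma(x-n-1)}\left(\psi(x) - \psi(x-n-1)\right),$$ where for $x\in\{1,2,\ldots,n+1\}$ the right-hand side is understood as its limiting value.
   Context: $\mathbb{N}_0=\{0,1,2,\ldots\}$; $\psi=\Gamma'/\Gamma$ is the digamma function. $(a)_n := a(a+1)\cdots(a+n-1)$ is the rising factorial, with $(a)_0=1$. Signed generalized Stirling polynomials of the first kind: for $m\in\mathbb{N}_0$ and $x\in\mathbb{C}$, $P_k(m,x)$, $0\le k\le m$, are defined by the polynomial identity in $j$ $$(j+1)_m = \sum_{k=0}^m (-1)^k P_k(m, x)\,(j + x)^{m-k}.$$ *)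

theory Defs
  imports "HOL-Analysis.Analysis" "HOL-Computational_Algebra.Polynomial"
begin

text \<open>
  \<open>stirling_coeffs m x c\<close>: the numbers \<open>c 0, \<dots>, c m\<close> satisfy the identity
  \<open>(j + 1)\<^sub>m = (\<Sum>k=0..m. (-1)^k c k (j + x)^(m-k))\<close> defining \<open>P\<^sub>k(m, x)\<close>. Values \<open>c k\<close> with
  \<open>k > m\<close>, which the identity does not involve, are fixed to \<open>0\<close> so that \<open>c\<close> is unique.
\<close>

definition stirling_coeffs :: "nat \<Rightarrow> complex \<Rightarrow> (nat \<Rightarrow> complex) \<Rightarrow> bool" where
  "stirling_coeffs m x c \<longleftrightarrow>
     (\<forall>j. pochhammer (j + 1) m = (\<Sum>k=0..m. (-1) ^ k * c k * (j + x) ^ (m - k))) \<and>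
     (\<forall>k>m. c k = 0)"

definition stirling_P :: "nat \<Rightarrow> nat \<Rightarrow> complex \<Rightarrow> complex" where
  "stirling_P k m x = (THE c. stirling_coeffs m x c) k"

lemma stirling_coeffs_ex: "\<exists>c. stirling_coeffs m x c"
proof -
  define q where "q = (\<Prod>i<m. [:1 - x + of_nat i, 1:])"
  have deg: "degree q \<le> m"
    unfolding q_def by (rule order.trans[OF degree_prod_sum_le]) auto
  have q: "poly q (j + x) = pochhammer (j + 1) m" for j
    by (simp add: q_def poly_prod pochhammer_prod algebra_simps lessThan_atLeast0)
  define c where "c = (\<lambda>k. if k \<le> m then (-1) ^ k * coeff q (m - k) else 0)"
  have "pochhammer (j + 1) m = (\<Sum>k=0..m. (-1) ^ k * c k * (j + x) ^ (m - k))" for j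
  proof -
    have "pochhammer (j + 1) m = (\<Sum>i\<le>degree q. coeff q i * (j + x) ^ i)"
      using q[of j] by (simp add: poly_altdef)
    also have "\<dots> = (\<Sum>i\<le>m. coeff q i * (j + x) ^ i)"
      using deg by (intro sum.mono_neutral_left) (auto simp: coeff_eq_0)
    also have "\<dots> = (\<Sum>k\<le>m. coeff q (m - k) * (j + x) ^ (m - k))"
      by (rule sum.reindex_bij_witness[of _ "\<lambda>k. m - k" "\<lambda>k. m - k"]) auto
    also have "\<dots> = (\<Sum>k=0..m. (-1) ^ k * c k * (j + x) ^ (m - k))"
      by (intro sum.cong) (auto simp: c_def atMost_atLeast0 mult.assoc[symmetric] 
            power_mult_distrib[symmetric])
    finally show ?thesis .
  qed
  then show ?thesis
    by (intro exI[of _ c]) (auto simp: stirling_coeffs_def c_def)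
qed

lemma stirling_coeffs_unique:
  assumes "stirling_coeffs m x c" "stirling_coeffs m x d"
  shows "c = d"
proof
  fix k
  define p where "p = (\<lambda>e. \<Sum>k=0..m. monom ((-1) ^ k * e k :: complex) (m - k))"
  have "poly (p c) t = poly (p d) t" for t
    using assms[unfolded stirling_coeffs_def, THEN conjunct1, THEN spec[of _ "t - x"]]
    by (simp add: p_def poly_sum poly_monom)
  then have eq: "p c = p d"
    by (simp add: poly_eq_poly_eq_iff[symmetric] fun_eq_iff)
  show "c k = d k"
  proof (cases "k \<le> m")
    case True
    have "coeff (p e) (m - k) = (-1) ^ k * e k" for e
    proof -
      have "coeff (p e) (m - k) = (\<Sum>i=0..m. if i = k then (-1) ^ i * e i else 0)"
        unfolding p_def coeff_sum using True by (intro sum.cong) auto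
      then show ?thesis using True by (simp add: sum.delta)
    qed
    with eq show ?thesis by (metis mult_left_cancel power_not_zero zero_neq_neg_one)
  next
    case False
    then show ?thesis using assms by (simp add: stirling_coeffs_def)
  qed
qed

lemma stirling_coeffs_stirling_P: "stirling_coeffs m x (\<lambda>k. stirling_P k m x)"
proof -
  have "\<exists>!c. stirling_coeffs m x c"
    using stirling_coeffs_ex stirling_coeffs_unique by blast
  from theI'[OF this] show ?thesis by (simp add: stirling_P_def)
qed

end

theory Submission
  imports Defs
begin

text \<open>
  Put \<open>m = n + 1\<close> and consider the falling factorial \<open>g z = (z - 1) \<dots> (z - m)\<close>, a polynomial in \<open>z\<close>
  that equals \<open>\<Gamma>(z) / \<Gamma>(z - m)\<close> away from the poles of the denominator.

  Up to sign, \<open>g z\<close> is the rising factorial \<open>(1 - z)\<^sub>m\<close>. So the identity defining the numbers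
  \<open>P\<^sub>k(m, x)\<close>, read at \<open>j = - z\<close>, is the Taylor expansion of \<open>g\<close> about \<open>x\<close>, and its linear
  coefficient says \<open>P\<^sub>n(m, x) = g' x\<close> (\<open>stirling_P_deriv\<close>). On the other hand, the
  logarithmic derivative of \<open>\<Gamma>(z) / \<Gamma>(z - m)\<close> is \<open>\<psi>(z) - \<psi>(z - m)\<close>
  (\<open>Gamma_ratio_deriv\<close>). Comparing the two gives the formula at every \<open>z\<close> for which \<open>z - m\<close> is
  not a pole. In the half-plane \<open>Re z > 0\<close> the exceptions are exactly \<open>1, \<dots>, m\<close>. They are isolated,
  and \<open>g'\<close> is continuous, so at them \<open>g'\<close> is the limit of the right-hand side.
\<close>

lemma stirling_P_deriv:
  "((\<lambda>z. pochhammer (z - of_nat (Suc n)) (Suc n)) has_field_derivative stirling_P n (Suc n) x) (at x)"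
proof -
  let ?m = "Suc n"
  let ?P = "\<lambda>k. stirling_P k ?m x"
  have expansion: "pochhammer (z - of_nat ?m) ?m =
      (-1) ^ ?m * (\<Sum>k=0..?m. (-1) ^ k * ?P k * (x - z) ^ (?m - k))" for z
  proof -
    have "pochhammer (z - of_nat ?m) ?m = (-1) ^ ?m * pochhammer (- z + 1) ?m"
    proof -
      have "z - of_nat ?m = (z - 1) - of_nat ?m + 1" "- z + 1 = - (z - 1)" by simp_all
      then show ?thesis by (simp only: pochhammer_minus')
    qed
    also have "pochhammer (- z + 1) ?m = (\<Sum>k=0..?m. (-1) ^ k * ?P k * (- z + x) ^ (?m - k))"
      using stirling_coeffs_stirling_P[of ?m x] unfolding stirling_coeffs_def by blast
    finally show ?thesis by simp
  qed
  have "((\<lambda>z. (-1) ^ ?m * (\<Sum>k=0..?m. (-1) ^ k * ?P k * (x - z) ^ (?m - k))) has_field_derivative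
      (-1) ^ ?m * (\<Sum>k=0..?m. (-1) ^ k * ?P k * (- of_nat (?m - k) * (x - x) ^ (?m - k - 1)))) (at x)"
    by (auto intro!: derivative_eq_intros sum.cong simp: algebra_simps)
  \<comment> \<open>At \<open>z = x\<close> only the term \<open>k = n\<close> survives; the term \<open>k = n + 1\<close> carries the factor \<open>0\<close>.\<close>
  moreover have "(\<Sum>k=0..?m. (-1) ^ k * ?P k * (- of_nat (?m - k) * (x - x) ^ (?m - k - 1))) =
      (\<Sum>k=0..?m. if k = n then - ((-1) ^ n * ?P n) else 0)"
    by (intro sum.cong refl) (auto simp: le_Suc_eq power_0_left)
  ultimately show ?thesis
    unfolding expansion
    by (simp add: mult.assoc[symmetric] power_mult_distrib[symmetric])
qed

lemma Gamma_ratio_deriv: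
  fixes z :: complex
  assumes "z - of_nat m \<notin> \<int>\<^sub>\<le>\<^sub>0"
  shows "((\<lambda>z. pochhammer (z - of_nat m) m) has_field_derivative
    Gamma z / Gamma (z - of_nat m) * (Digamma z - Digamma (z - of_nat m))) (at z)"
proof -
  let ?U = "(\<lambda>z. z - of_nat m) -` (- \<int>\<^sub>\<le>\<^sub>0 :: complex set)"
  have z: "z \<notin> \<int>\<^sub>\<le>\<^sub>0"
    using assms nonpos_Ints_diff_Nats[of z "of_nat m"] by auto
  have nz: "Gamma (z - of_nat m) \<noteq> 0"
    using assms by (simp add: Gamma_eq_zero_iff)
  have "((\<lambda>z. Gamma z / Gamma (z - of_nat m)) has_field_derivative
      Gamma z / Gamma (z - of_nat m) * (Digamma z - Digamma (z - of_nat m))) (at z)"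
    using assms z nz by (auto intro!: derivative_eq_intros simp: field_simps)
  moreover have "open ?U"
    by (intro open_vimage open_Compl closed_nonpos_Ints continuous_intros)
  moreover have "Gamma w / Gamma (w - of_nat m) = pochhammer (w - of_nat m) m" if "w \<in> ?U" for w
    using that by (simp add: pochhammer_Gamma)
  ultimately show ?thesis
    using assms by (elim has_field_derivative_transform_within_open) auto
qed

lemma stirling_P_eq_Gamma_Digamma:
  assumes "z - of_nat (Suc n) \<notin> \<int>\<^sub>\<le>\<^sub>0"
  shows "stirling_P n (Suc n) z =
    Gamma z / Gamma (z - of_nat (Suc n)) * (Digamma z - Digamma (z - of_nat (Suc n)))"
  using stirling_P_deriv Gamma_ratio_deriv[OF assms] by (rule DERIV_unique)

text \<open>By \<open>stirling_P_deriv\<close>, the values at varying \<open>x\<close> are those of the derivative of one fixed polynomial.\<close>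

lemma continuous_stirling_P: "isCont (stirling_P n (Suc n)) x"
proof -
  define p where "p = (\<Prod>i<Suc n. [:of_nat i - of_nat (Suc n), 1 :: complex:])"
  have p: "poly p = (\<lambda>z. pochhammer (z - of_nat (Suc n)) (Suc n))"
    unfolding p_def poly_prod pochhammer_prod
    by (intro ext prod.cong) (auto simp: algebra_simps)
  have "stirling_P n (Suc n) z = poly (pderiv p) z" for z
    using stirling_P_deriv[of n z] poly_DERIV[of p z] unfolding p by (rule DERIV_unique)
  then have "stirling_P n (Suc n) = poly (pderiv p)" by (intro ext)
  then show ?thesis by simp
qed

lemma diff_of_nat_nonpos_Int_imp:
  fixes z :: complex
  assumes "Re z > 0" and "z - of_nat m \<in> \<int>\<^sub>\<le>\<^sub>0"
  shows "z \<in> of_nat ` {1..m}"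
proof -
  from assms(2) obtain k where "z - of_nat m = - of_nat k"
    by (elim nonpos_Ints_cases')
  then have z: "z = of_nat m - of_nat k" by (simp add: algebra_simps)
  then have "k < m" using assms(1) by simp
  with z show ?thesis
    by (intro image_eqI[of _ _ "m - k"]) (auto simp: of_nat_diff)
qed

theorem mainTheorem11:
  fixes n :: nat and x :: complex
  assumes "Re x > 0"
  shows "(x \<notin> of_nat ` {1..n + 1} \<longrightarrow>
            stirling_P n (n + 1) x =
              Gamma x / Gamma (x - of_nat n - 1) * (Digamma x - Digamma (x - of_nat n - 1))) \<and>
         (x \<in> of_nat ` {1..n + 1} \<longrightarrow>
            ((\<lambda>z. Gamma z / Gamma (z - of_nat n - 1) * (Digamma z - Digamma (z - of_nat n - 1)))
               \<longlongrightarrow> stirling_P n (n + 1) x) (at x))"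
proof -
  let ?R = "\<lambda>z. Gamma z / Gamma (z - of_nat n - 1) * (Digamma z - Digamma (z - of_nat n - 1))"
  have formula: "stirling_P n (n + 1) z = ?R z"
    if "Re z > 0" "z \<notin> of_nat ` {1..n + 1}" for z :: complex
  proof -
    have "z - of_nat (Suc n) \<notin> \<int>\<^sub>\<le>\<^sub>0"
      using that diff_of_nat_nonpos_Int_imp[of z "Suc n"] by auto
    then show ?thesis
      using stirling_P_eq_Gamma_Digamma[of z n] by (simp add: diff_diff_eq add.commute)
  qed
  have "eventually (\<lambda>z. Re z > 0) (at x)"
    using assms by (intro order_tendstoD(1)[of Re "Re x"] tendsto_intros)
  moreover have "eventually (\<lambda>z. z \<notin> of_nat ` {1..n + 1}) (at x)"
  proof -
    have "finite (of_nat ` {1..n + 1} :: complex set)" by simp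
    then have "\<not> x islimpt (of_nat ` {1..n + 1})" by (rule islimpt_finite)
    then show ?thesis unfolding islimpt_iff_eventually by simp
  qed
  ultimately have "eventually (\<lambda>z. stirling_P n (n + 1) z = ?R z) (at x)"
    by eventually_elim (rule formula)
  moreover have "(stirling_P n (n + 1) \<longlongrightarrow> stirling_P n (n + 1) x) (at x)"
    using continuous_stirling_P[of x n] by (simp add: isCont_def)
  ultimately have "(?R \<longlongrightarrow> stirling_P n (n + 1) x) (at x)"
    by (rule Lim_transform_eventually[rotated])
  with formula[OF assms] show ?thesis by blast
qed

end
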